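(* Let $C$ be a $p\times p$ correlation matrix, $\lambda\ge 0$ and $\alpha<1$. The function \[ F(R,D)=-\log\det(R)-2(1-\alpha)\log\det(D) +\operatorname{tr}( C DRD)+ \lambda \|R\|_{1,\mathrm{off}} \] on $\mathrm{S}_{++}^{(1)}\times\mathrm{Diag}_+$ is strictly biconvex, but it is not globally (jointly) convex on $\mathrm{S}_{++}^{(1)}\times\mathrm{Diag}_+$ unless $C=I_p$.
   Context: $\mathrm{S}_{++}^{(1)}$ is the (convex) set of real symmetric positive definite $p\times p$ matrices with unit diagonal; $\mathrm{Diag}_+$ is the (convex) set of $p\times p$ diagonal matrices with strictly positive diagonal entries. A correlation matrix is a symmetric positive semidefinite matrix with unit diagonal. $\|R\|_{1,\mathrm{off}}=\sum_{i\ne j}|R_{ij}|$. A function $f\colon\mathcal R\times\mathcal D\to\mathbb{R}$ is strictly biconvex if for every fixed $R\in\mathcal{R}$ the map $D\mapsto f(R,D)$ is strictly convex and for every fixed $D\in\mathcal{D}$ the map $R\mapsto f(R,D)$ is strictly convex. *)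

theory Defs
  imports "HOL-Analysis.Analysis"
begin

definition symmetric_matrix :: "real^'p^'p \<Rightarrow> bool" where
  "symmetric_matrix A \<longleftrightarrow> transpose A = A"

definition pos_semidef :: "real^'p^'p \<Rightarrow> bool" where
  "pos_semidef A \<longleftrightarrow> symmetric_matrix A \<and> (\<forall>x. 0 \<le> x \<bullet> (A *v x))"

definition pos_def :: "real^'p^'p \<Rightarrow> bool" where
  "pos_def A \<longleftrightarrow> symmetric_matrix A \<and> (\<forall>x. x \<noteq> 0 \<longrightarrow> 0 < x \<bullet> (A *v x))"

definition unit_diagonal :: "real^'p^'p \<Rightarrow> bool" where
  "unit_diagonal A \<longleftrightarrow> (\<forall>i. A $ i $ i = 1)"

definition correlation_matrix :: "real^'p^'p \<Rightarrow> bool" where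
  "correlation_matrix A \<longleftrightarrow> pos_semidef A \<and> unit_diagonal A"

definition pos_def_unit_diag :: "(real^'p^'p) set" where
  "pos_def_unit_diag = {R. pos_def R \<and> unit_diagonal R}"

definition pos_diagonal :: "(real^'p^'p) set" where
  "pos_diagonal = {D. (\<forall>i j. i \<noteq> j \<longrightarrow> D $ i $ j = 0) \<and> (\<forall>i. 0 < D $ i $ i)}"

definition off_diag_norm1 :: "real^'p^'p \<Rightarrow> real" where
  "off_diag_norm1 R = (\<Sum>i\<in>UNIV. \<Sum>j\<in>UNIV - {i}. \<bar>R $ i $ j\<bar>)"

text \<open>Like \<^const>\<open>convex_on\<close>, strict convexity includes convexity of the domain.\<close>

definition strictly_convex_on :: "'a::real_vector set \<Rightarrow> ('a \<Rightarrow> real) \<Rightarrow> bool" where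
  "strictly_convex_on S f \<longleftrightarrow> convex S \<and>
    (\<forall>x\<in>S. \<forall>y\<in>S. \<forall>u>0. \<forall>v>0. x \<noteq> y \<longrightarrow> u + v = 1 \<longrightarrow>
      f (u *\<^sub>R x + v *\<^sub>R y) < u * f x + v * f y)"

definition strictly_biconvex_on ::
  "'a::real_vector set \<Rightarrow> 'b::real_vector set \<Rightarrow> ('a \<Rightarrow> 'b \<Rightarrow> real) \<Rightarrow> bool" where
  "strictly_biconvex_on X Y f \<longleftrightarrow>
    (\<forall>x\<in>X. strictly_convex_on Y (\<lambda>y. f x y)) \<and>
    (\<forall>y\<in>Y. strictly_convex_on X (\<lambda>x. f x y))"

definition objective ::
  "real^'p^'p \<Rightarrow> real \<Rightarrow> real \<Rightarrow> real^'p^'p \<Rightarrow> real^'p^'p \<Rightarrow> real" where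
  "objective C lam \<alpha> R D =
    - ln (det R) - 2 * (1 - \<alpha>) * ln (det D) + trace (C ** D ** R ** D) + lam * off_diag_norm1 R"

end

theory Submission
  imports Defs
begin

text \<open>Two quadratic forms, one of them positive definite, are diagonalised by a common congruence:
maximise one form on the unit sphere of the other and continue in the orthogonal complement. This
reduces strict concavity of \<open>ln det\<close> on positive definite matrices to that of \<open>ln\<close>. The trace term
is linear in \<open>R\<close>; in \<open>D\<close> it is a quadratic form, positive semidefinite because \<open>R = Q\<^sup>T Q\<close>.

For \<open>C = I\<close> the trace term is \<open>tr(D\<^sup>2)\<close>, whence joint convexity. For \<open>C \<noteq> I\<close> convexity fails at the
midpoint of \<open>(I, (t + 1) I)\<close> and \<open>((I + C) / 2, (t - 1) I)\<close> for large \<open>t\<close>: the excess of the trace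
term is \<open>O(1) - a t / 2\<close> with \<open>a = tr(C\<^sup>2) - p > 0\<close>, while all other terms contribute only \<open>O(1)\<close>.\<close>

section \<open>Simultaneous diagonalisation of two quadratic forms by congruence\<close>

lemma symmetric_matrix_form_commute:
  fixes A :: "real^'p^'p"
  assumes "symmetric_matrix A"
  shows "x \<bullet> (A *v y) = y \<bullet> (A *v x)"
  using assms by (metis dot_lmul_matrix inner_commute symmetric_matrix_def transpose_matrix_vector)

text \<open>A zero of a nonnegative form is a minimum, so the derivative there,
  \<open>2 * (w \<bullet> (Q *v y))\<close> in direction \<open>y\<close>, vanishes. Nonnegativity
  is asked on a subspace because the form met later, a multiple of \<open>A\<close> minus
  \<open>B\<close>, is controlled only on an orthogonal complement.\<close>

lemma pos_semidef_form_eq_0: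
  fixes Q :: "real^'p^'p"
  assumes sym: "symmetric_matrix Q" and S: "subspace S"
    and nonneg: "\<And>x. x \<in> S \<Longrightarrow> 0 \<le> x \<bullet> (Q *v x)"
    and w: "w \<in> S" "w \<bullet> (Q *v w) = 0" and y: "y \<in> S"
  shows "w \<bullet> (Q *v y) = 0"
proof (rule ccontr)
  define b where "b = w \<bullet> (Q *v y)"
  define c where "c = y \<bullet> (Q *v y)"
  assume "w \<bullet> (Q *v y) \<noteq> 0"
  then have b: "b \<noteq> 0" by (simp add: b_def)
  have c: "0 \<le> c" using nonneg[OF y] by (simp add: c_def)
  have form: "(w + t *\<^sub>R y) \<bullet> (Q *v (w + t *\<^sub>R y)) = 2 * t * b + t\<^sup>2 * c" for t
    using w(2) symmetric_matrix_form_commute[OF sym, of y w]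
    by (simp add: b_def c_def matrix_vector_right_distrib matrix_vector_mult_scaleR
        inner_add_left inner_add_right power2_eq_square algebra_simps)
  have "0 \<le> 2 * t * b + t\<^sup>2 * c" for t
    using nonneg[of "w + t *\<^sub>R y"] S w(1) y form by (simp add: subspace_add subspace_mul)
  \<comment> \<open>The minimiser would be \<open>- b / c\<close>; the denominator
    \<open>c + 1\<close> also covers \<open>c = 0\<close> and still makes the value
    negative.\<close>
  from this[of "- b / (c + 1)"] have "0 \<le> - (2 * b\<^sup>2) / (c + 1) + b\<^sup>2 * c / (c + 1)\<^sup>2"
    by (simp add: power2_eq_square)
  also have "\<dots> = - b\<^sup>2 * (c + 2) / (c + 1)\<^sup>2"
    using c by (simp add: divide_simps) (simp add: algebra_simps power2_eq_square)
  also have "\<dots> < 0"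
    using b c by (intro divide_neg_pos) (auto intro!: mult_neg_pos)
  finally show False by simp
qed

text \<open>The Rayleigh quotient of \<open>B\<close> against \<open>A\<close> attains its maximum
  on the compact unit sphere of \<open>S\<close>, and its homogeneity of degree 0 carries the bound
  to all of \<open>S\<close>. The vector \<open>z\<close> keeps that sphere nonempty.\<close>

lemma pos_def_form_max:
  fixes A B :: "real^'p^'p"
  assumes A: "pos_def A" and S: "subspace S" and z: "z \<in> S" "z \<noteq> 0"
  obtains w where "w \<in> S" "w \<bullet> (A *v w) = 1"
    "\<And>x. x \<in> S \<Longrightarrow> x \<bullet> (B *v x) \<le> (w \<bullet> (B *v w)) * (x \<bullet> (A *v x))"
proof -
  have hom: "(t *\<^sub>R x) \<bullet> (M *v (t *\<^sub>R x)) = t\<^sup>2 * (x \<bullet> (M *v x))" for t x and M :: "real^'p^'p"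
    by (simp add: matrix_vector_mult_scaleR power2_eq_square)
  have pos: "0 < x \<bullet> (A *v x)" if "x \<noteq> 0" for x
    using A that by (simp add: pos_def_def)
  have cont: "continuous_on X (\<lambda>x. x \<bullet> (M *v x))" for X and M :: "real^'p^'p"
    by (intro continuous_intros linear_continuous_on matrix_vector_mul_bounded_linear)
  define U where "U = S \<inter> sphere 0 1"
  have norml: "(1 / norm x) *\<^sub>R x \<in> U" if "x \<in> S" "x \<noteq> 0" for x
    using that S by (simp add: U_def subspace_mul)
  have "compact U"
    unfolding U_def by (intro closed_Int_compact closed_subspace S) auto
  moreover have "U \<noteq> {}" using norml[OF z] by auto
  moreover have "continuous_on U (\<lambda>x. (x \<bullet> (B *v x)) / (x \<bullet> (A *v x)))"
  proof (intro continuous_on_divide cont ballI)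
    fix x assume "x \<in> U"
    then have "x \<noteq> 0" by (auto simp: U_def)
    then show "x \<bullet> (A *v x) \<noteq> 0" using pos[of x] by simp
  qed
  ultimately obtain w0 where w0: "w0 \<in> U" and
    max: "\<And>x. x \<in> U \<Longrightarrow> (x \<bullet> (B *v x)) / (x \<bullet> (A *v x)) \<le> (w0 \<bullet> (B *v w0)) / (w0 \<bullet> (A *v w0))"
    using continuous_attains_sup[of U] by blast
  have "w0 \<noteq> 0" using w0 by (auto simp: U_def)
  define a where "a = w0 \<bullet> (A *v w0)"
  have a: "a > 0" using pos[OF \<open>w0 \<noteq> 0\<close>] by (simp add: a_def)
  define w where "w = (1 / sqrt a) *\<^sub>R w0"
  have wM: "w \<bullet> (M *v w) = (w0 \<bullet> (M *v w0)) / a" for M :: "real^'p^'p"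
    unfolding w_def hom using a by (simp add: power_divide)
  show thesis
  proof
    show "w \<in> S" using w0 S by (simp add: w_def U_def subspace_mul)
    show "w \<bullet> (A *v w) = 1" using wM[of A] a by (simp add: a_def)
    fix x assume x: "x \<in> S"
    show "x \<bullet> (B *v x) \<le> (w \<bullet> (B *v w)) * (x \<bullet> (A *v x))"
    proof (cases "x = 0")
      case False
      have "(x \<bullet> (B *v x)) / (x \<bullet> (A *v x)) \<le> w \<bullet> (B *v w)"
        using max[OF norml[OF x False]] False unfolding wM hom by (simp add: a_def)
      then show ?thesis using pos[OF False] by (simp add: pos_divide_le_eq)
    qed simp
  qed
qed

lemma exists_nonzero_orthogonal:
  fixes g :: "'p::finite \<Rightarrow> real^'p"
  assumes "I \<noteq> UNIV"
  obtains z where "z \<noteq> 0" "\<And>i. i \<in> I \<Longrightarrow> g i \<bullet> z = 0"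
proof -
  have "card I < CARD('p)"
    using assms by (intro psubset_card_mono) auto
  then have "dim (g ` I) < DIM(real^'p)"
    using dim_le_card[of "g ` I" "g ` I"] card_image_le[of I g]
    by (simp add: span_superset)
  from orthogonal_to_subspace_exists[OF this]
  obtain z where "z \<noteq> 0" "\<And>y. y \<in> span (g ` I) \<Longrightarrow> orthogonal z y" by blast
  then show thesis
    by (intro that[of z]) (auto simp: orthogonal_def inner_commute[of z] span_base)
qed

text \<open>The last conjunct keeps the induction going: a vector that is \<open>A\<close>-orthogonal to the system so
far is automatically \<open>B\<close>-orthogonal to it.\<close>

lemma simultaneous_orthogonal_system:
  fixes A B :: "real^'p^'p"
  assumes A: "pos_def A" and B: "symmetric_matrix B"
  shows "\<exists>f :: 'p \<Rightarrow> real^'p.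
    (\<forall>i\<in>I. \<forall>j\<in>I. f i \<bullet> (A *v f j) = (if i = j then 1 else 0)) \<and>
    (\<forall>i\<in>I. \<forall>j\<in>I. i \<noteq> j \<longrightarrow> f i \<bullet> (B *v f j) = 0) \<and>
    (\<forall>y. (\<forall>i\<in>I. f i \<bullet> (A *v y) = 0) \<longrightarrow> (\<forall>i\<in>I. f i \<bullet> (B *v y) = 0))"
  using finite[of I]
proof (induction I rule: finite_induct)
  case empty
  then show ?case by simp
next
  case (insert k I)
  have symA: "symmetric_matrix A" using A by (simp add: pos_def_def)
  note commA = symmetric_matrix_form_commute[OF symA]
  note commB = symmetric_matrix_form_commute[OF B]
  from insert.IH obtain f :: "'p \<Rightarrow> real^'p" where
    f: "\<forall>i\<in>I. \<forall>j\<in>I. f i \<bullet> (A *v f j) = (if i = j then 1 else 0)"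
      "\<forall>i\<in>I. \<forall>j\<in>I. i \<noteq> j \<longrightarrow> f i \<bullet> (B *v f j) = 0"
      "\<forall>y. (\<forall>i\<in>I. f i \<bullet> (A *v y) = 0) \<longrightarrow> (\<forall>i\<in>I. f i \<bullet> (B *v y) = 0)"
    by blast
  have fA: "f i \<bullet> (A *v f j) = (if i = j then 1 else 0)" if "i \<in> I" "j \<in> I" for i j
    using f(1) that by blast
  have fB: "f i \<bullet> (B *v f j) = 0" if "i \<in> I" "j \<in> I" "i \<noteq> j" for i j
    using f(2) that by blast
  have fy: "f i \<bullet> (B *v y) = 0" if "\<And>i. i \<in> I \<Longrightarrow> f i \<bullet> (A *v y) = 0" "i \<in> I" for y i
    using f(3) that by blast
  define S where "S = {y. \<forall>i\<in>I. f i \<bullet> (A *v y) = 0}"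
  have S: "subspace S"
    by (auto simp: S_def subspace_def matrix_vector_right_distrib matrix_vector_mult_scaleR
        inner_add_right)
  \<comment> \<open>\<open>k\<close> lies outside \<open>I\<close>, so \<open>I\<close> is not the
    whole index type and \<open>S\<close> contains a nonzero vector to start the
    maximisation.\<close>
  obtain z where "z \<noteq> 0" and z: "\<And>i. i \<in> I \<Longrightarrow> (A *v f i) \<bullet> z = 0"
    using exists_nonzero_orthogonal[of I "\<lambda>i. A *v f i"] insert.hyps by blast
  have "z \<in> S"
    unfolding S_def using z commA by (simp add: inner_commute)
  obtain w where w: "w \<in> S" "w \<bullet> (A *v w) = 1"
    and max: "\<And>x. x \<in> S \<Longrightarrow> x \<bullet> (B *v x) \<le> (w \<bullet> (B *v w)) * (x \<bullet> (A *v x))"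
    using pos_def_form_max[OF A S \<open>z \<in> S\<close> \<open>z \<noteq> 0\<close>] by blast
  define m where "m = w \<bullet> (B *v w)"
  \<comment> \<open>By maximality \<open>Q\<close> is nonnegative on \<open>S\<close> and vanishes
    at \<open>w\<close>. Hence \<open>w\<close> is \<open>Q\<close>-orthogonal to \<open>S\<close>,
    which is the generalised eigenvalue equation \<open>B w = m A w\<close> tested against
    \<open>S\<close>.\<close>
  define Q where "Q = m *\<^sub>R A - B"
  have Q: "x \<bullet> (Q *v y) = m * (x \<bullet> (A *v y)) - x \<bullet> (B *v y)" for x y
    by (simp add: Q_def matrix_vector_mult_diff_rdistrib scaleR_matrix_vector_assoc [symmetric]
        inner_diff_right)
  have symQ: "symmetric_matrix Q"
    using symA B unfolding symmetric_matrix_def Q_def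
    by (simp add: transpose_def vec_eq_iff)
  have wB: "w \<bullet> (B *v y) = m * (w \<bullet> (A *v y))" if "y \<in> S" for y
  proof -
    have "w \<bullet> (Q *v y) = 0"
    proof (rule pos_semidef_form_eq_0[OF symQ S _ w(1) _ that])
      show "0 \<le> x \<bullet> (Q *v x)" if "x \<in> S" for x
        using max[OF that] by (simp add: Q m_def)
      show "w \<bullet> (Q *v w) = 0" by (simp add: Q m_def w(2))
    qed
    then show ?thesis by (simp add: Q)
  qed
  have wI: "f i \<bullet> (A *v w) = 0" "w \<bullet> (A *v f i) = 0" if "i \<in> I" for i
    using w(1) that commA[of w "f i"] by (auto simp: S_def)
  have wIB: "f i \<bullet> (B *v w) = 0" "w \<bullet> (B *v f i) = 0" if "i \<in> I" for i
    using fy[of w i] wI that commB[of w "f i"] by auto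
  define h where "h = f(k := w)"
  have hI: "h i = f i" if "i \<in> I" for i using that insert.hyps by (auto simp: h_def)
  have hk: "h k = w" by (simp add: h_def)
  show ?case
  proof (intro exI[of _ h] conjI)
    show "\<forall>i\<in>insert k I. \<forall>j\<in>insert k I. h i \<bullet> (A *v h j) = (if i = j then 1 else 0)"
      using fA wI w(2) insert.hyps by (auto simp: hI hk)
    show "\<forall>i\<in>insert k I. \<forall>j\<in>insert k I. i \<noteq> j \<longrightarrow> h i \<bullet> (B *v h j) = 0"
      using fB wIB insert.hyps by (auto simp: hI hk)
    show "\<forall>y. (\<forall>i\<in>insert k I. h i \<bullet> (A *v y) = 0) \<longrightarrow> (\<forall>i\<in>insert k I. h i \<bullet> (B *v y) = 0)"
    proof (intro allI impI)
      fix y assume y: "\<forall>i\<in>insert k I. h i \<bullet> (A *v y) = 0"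
      then have "y \<in> S" "w \<bullet> (A *v y) = 0" by (auto simp: S_def hI hk)
      then show "\<forall>i\<in>insert k I. h i \<bullet> (B *v y) = 0"
        using wB[of y] fy[of y] by (auto simp: hI hk S_def)
    qed
  qed
qed

text \<open>Passes between vectors and matrices: orthogonality relations among columns become matrix
  identities, and traces of such products become sums of form values.\<close>

lemma congruence_entry:
  fixes A P :: "real^'p^'p"
  shows "(transpose P ** A ** P) $ i $ j = column i P \<bullet> (A *v column j P)"
proof -
  have "(transpose P ** A ** P) $ i $ j = (\<Sum>k\<in>UNIV. \<Sum>l\<in>UNIV. P$l$i * A$l$k * P$k$j)"
    by (simp add: matrix_matrix_mult_def transpose_def sum_distrib_right)
  also have "\<dots> = (\<Sum>l\<in>UNIV. \<Sum>k\<in>UNIV. P$l$i * A$l$k * P$k$j)"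
    by (rule sum.swap)
  also have "\<dots> = column i P \<bullet> (A *v column j P)"
    by (simp add: inner_vec_def matrix_vector_mult_def column_def sum_distrib_left mult.assoc)
  finally show ?thesis .
qed

text \<open>The system for the full index set supplies the columns of \<open>P\<close>. Recording
  \<open>l i\<close> as the form of \<open>B\<close> at a nonzero vector gives its positivity once
  \<open>B\<close> is positive definite.\<close>

lemma simultaneous_diagonalization:
  fixes A B :: "real^'p^'p"
  assumes A: "pos_def A" and B: "symmetric_matrix B"
  obtains P :: "real^'p^'p" and l where "transpose P ** A ** P = mat 1"
    "transpose P ** B ** P = (\<chi> i j. if i = j then l i else 0)"
    "\<And>i. l i = column i P \<bullet> (B *v column i P)" "\<And>i. column i P \<noteq> 0"
proof -
  obtain f :: "'p \<Rightarrow> real^'p" where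
    fA: "\<And>i j. f i \<bullet> (A *v f j) = (if i = j then 1 else 0)" and
    fB: "\<And>i j. i \<noteq> j \<Longrightarrow> f i \<bullet> (B *v f j) = 0"
    using simultaneous_orthogonal_system[OF A B, of UNIV] by auto
  define P :: "real^'p^'p" where "P = (\<chi> i j. f j $ i)"
  have col: "column j P = f j" for j by (simp add: P_def column_def vec_eq_iff)
  show thesis
  proof (rule that[of P "\<lambda>i. f i \<bullet> (B *v f i)"])
    show "transpose P ** A ** P = mat 1"
      by (simp add: vec_eq_iff congruence_entry col fA mat_def)
    show "transpose P ** B ** P = (\<chi> i j. if i = j then f i \<bullet> (B *v f i) else 0)"
      by (simp add: vec_eq_iff congruence_entry col fB)
    show "column i P \<noteq> 0" for i using fA[of i i] by (auto simp: col)
  qed (simp add: col)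
qed

lemma invertible_of_congruence:
  fixes A P :: "real^'p^'p"
  assumes "transpose P ** A ** P = mat 1"
  shows "invertible P"
  using assms invertible_left_inverse by blast

section \<open>Strict concavity of \<open>ln det\<close> on positive definite matrices\<close>

text \<open>Concavity of \<open>ln\<close> between the points 1 and \<open>l\<close>, where
  \<open>u * ln 1\<close> is 0. The bound \<open>ln x \<le> x - 1\<close> is applied at
  \<open>1 / m\<close> and \<open>l / m\<close>; since \<open>m\<close> is the weighted mean, the
  weighted right-hand sides cancel. Equality needs \<open>m = 1\<close>, that is
  \<open>l = 1\<close>.\<close>

lemma ln_weighted_sum_ge:
  fixes l u v :: real
  assumes "0 < l" "0 < u" "0 < v" "u + v = 1"
  shows "v * ln l \<le> ln (u + v * l)" and "l \<noteq> 1 \<Longrightarrow> v * ln l < ln (u + v * l)"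
proof -
  define m where "m = u + v * l"
  have m: "m > 0" using assms by (simp add: m_def add_pos_pos)
  have 1: "u * ln (1 / m) \<le> u * (1 / m - 1)"
    using m assms by (intro mult_left_mono ln_le_minus_one) auto
  have 2: "v * ln (l / m) \<le> v * (l / m - 1)"
    using m assms by (intro mult_left_mono ln_le_minus_one) auto
  have z: "u * (1 / m - 1) + v * (l / m - 1) = 0"
  proof -
    have "u * (1 / m - 1) + v * (l / m - 1) = (u + v * l) / m - (u + v)"
      by (simp add: algebra_simps add_divide_distrib)
    then show ?thesis using m assms(4) by (simp add: m_def)
  qed
  have e: "u * ln (1 / m) + v * ln (l / m) = v * ln l - ln m"
  proof -
    have "u * ln (1 / m) + v * ln (l / m) = v * ln l - (u + v) * ln m"
      using m assms(1) by (simp add: ln_div algebra_simps)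
    then show ?thesis using assms(4) by simp
  qed
  show "v * ln l \<le> ln (u + v * l)"
    using 1 2 z e by (simp add: m_def)
  assume "l \<noteq> 1"
  have "m - 1 = v * (l - 1)" using assms(4) by (simp add: m_def algebra_simps)
  then have "m \<noteq> 1" using assms(3) \<open>l \<noteq> 1\<close> by auto
  have "ln (1 / m) \<noteq> 1 / m - 1"
    using ln_eq_minus_one[of "1 / m"] m \<open>m \<noteq> 1\<close> by auto
  with 1 have "u * ln (1 / m) < u * (1 / m - 1)"
    using assms(2) by simp
  then show "v * ln l < ln (u + v * l)"
    using 2 z e by (simp add: m_def)
qed

text \<open>A congruence turns \<open>A\<close> into the identity and \<open>B\<close> into a
  diagonal matrix, and multiplies every determinant by the same \<open>c\<close>, whose logarithm
  cancels as the weights sum to 1. What remains is the scalar inequality for each diagonal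
  entry.\<close>

lemma ln_det_strictly_concave:
  fixes A B :: "real^'p^'p"
  assumes A: "pos_def A" and B: "pos_def B" and "A \<noteq> B"
    and uv: "0 < u" "0 < v" "u + v = 1"
  shows "u * ln (det A) + v * ln (det B) < ln (det (u *\<^sub>R A + v *\<^sub>R B))"
proof -
  define Z where "Z = u *\<^sub>R A + v *\<^sub>R B"
  have symB: "symmetric_matrix B" using B by (simp add: pos_def_def)
  obtain P :: "real^'p^'p" and l where PA: "transpose P ** A ** P = mat 1"
    and PB: "transpose P ** B ** P = (\<chi> i j. if i = j then l i else 0)"
    and l: "\<And>i. l i = column i P \<bullet> (B *v column i P)" and P0: "\<And>i. column i P \<noteq> 0"
    using simultaneous_diagonalization[OF A symB] by blast
  have lpos: "0 < l i" for i using B P0 l by (simp add: pos_def_def)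
  have PZ: "transpose P ** Z ** P = (\<chi> i j. if i = j then u + v * l i else 0)"
  proof -
    have "transpose P ** Z ** P = u *\<^sub>R (transpose P ** A ** P) + v *\<^sub>R (transpose P ** B ** P)"
      by (simp add: Z_def vec_eq_iff congruence_entry matrix_vector_mult_add_rdistrib
          scaleR_matrix_vector_assoc [symmetric] inner_add_right)
    then show ?thesis by (simp add: PA PB vec_eq_iff mat_def)
  qed
  have inv: "invertible P" by (rule invertible_of_congruence[OF PA])
  define c where "c = (det P)\<^sup>2"
  have c: "c > 0" using inv by (simp add: c_def invertible_det_nz)
  have cong: "det (transpose P ** M ** P) = c * det M" for M
    by (simp add: det_mul c_def power2_eq_square)
  have cA: "c * det A = 1" using cong[of A] by (simp add: PA)
  have cB: "c * det B = (\<Prod>i\<in>UNIV. l i)"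
    using cong[of B] by (simp add: PB det_diagonal)
  have cZ: "c * det Z = (\<Prod>i\<in>UNIV. u + v * l i)"
    using cong[of Z] by (simp add: PZ det_diagonal)
  have m: "0 < u + v * l i" for i using uv lpos by (simp add: add_pos_pos)
  have dA: "0 < det A" and dB: "0 < det B" and dZ: "0 < det Z"
    using c cA cB cZ prod_pos[of UNIV l] prod_pos[of UNIV "\<lambda>i. u + v * l i"] lpos m
    by (metis zero_less_mult_pos zero_less_one)+
  have lA: "ln (det A) = - ln c" using ln_mult_pos[OF c dA] cA by simp
  have lB: "ln (det B) = (\<Sum>i\<in>UNIV. ln (l i)) - ln c"
    using ln_mult_pos[OF c dB] cB lpos by (simp add: ln_prod less_imp_neq[symmetric])
  have lZ: "ln (det Z) = (\<Sum>i\<in>UNIV. ln (u + v * l i)) - ln c"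
    using ln_mult_pos[OF c dZ] cZ m by (simp add: ln_prod less_imp_neq[symmetric])
  \<comment> \<open>Source of strictness: were all \<open>l i\<close> equal to 1, undoing the
    congruence would give \<open>A = B\<close>.\<close>
  have "\<exists>i. l i \<noteq> 1"
  proof (rule ccontr)
    assume "\<not> ?thesis"
    then have "transpose P ** A ** P = transpose P ** B ** P"
      by (simp add: PA PB vec_eq_iff mat_def)
    moreover obtain Q where Q: "P ** Q = mat 1" using inv by (auto simp: invertible_def)
    moreover from Q have "transpose Q ** transpose P = mat 1"
      by (metis matrix_transpose_mul transpose_mat)
    ultimately have "A = B"
      by (metis matrix_mul_assoc matrix_mul_lid matrix_mul_rid)
    then show False using \<open>A \<noteq> B\<close> by simp
  qed
  then obtain i where i: "l i \<noteq> 1" by blast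
  have "(\<Sum>i\<in>UNIV. v * ln (l i)) < (\<Sum>i\<in>UNIV. ln (u + v * l i))"
    using ln_weighted_sum_ge[OF lpos uv] i by (intro sum_strict_mono_ex1) auto
  moreover have "u * ln c + v * ln c = ln c"
    by (metis uv(3) distrib_right mult_1)
  ultimately show ?thesis
    by (simp add: lA lB lZ Z_def[symmetric] sum_distrib_left algebra_simps)
qed

text \<open>Distinct points of the product domain may share a component, so joint convexity calls
  for this weak form.\<close>

lemma ln_det_concave:
  fixes A B :: "real^'p^'p"
  assumes "pos_def A" "pos_def B" "0 < u" "0 < v" "u + v = 1"
  shows "u * ln (det A) + v * ln (det B) \<le> ln (det (u *\<^sub>R A + v *\<^sub>R B))"
proof (cases "A = B")
  case True
  then show ?thesis
    using assms(5) by (metis distrib_right mult_1 order_refl scaleR_left_distrib scaleR_one)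
next
  case False
  then show ?thesis using ln_det_strictly_concave[OF assms(1,2) False assms(3-)] by simp
qed

section \<open>The trace term as a quadratic form\<close>

lemma trace_scaleR: "trace (c *\<^sub>R A) = c * trace (A :: real^'p^'p)"
  by (simp add: trace_def sum_distrib_left)

text \<open>With \<open>R\<close> written as \<open>transpose Q ** Q\<close> and
  \<open>Y = X ** transpose Q\<close>, cyclicity of the trace gives
  \<open>trace (transpose Y ** C ** Y)\<close>, a sum of values of the form of
  \<open>C\<close>.\<close>

lemma trace_congruence_nonneg:
  fixes C R X :: "real^'p^'p"
  assumes C: "pos_semidef C" and R: "pos_def R" and X: "symmetric_matrix X"
  shows "0 \<le> trace (C ** X ** R ** X)"
proof -
  have symR: "symmetric_matrix R" using R by (simp add: pos_def_def)
  \<comment> \<open>Diagonalising \<open>R\<close> against itself yields \<open>P\<close>; its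
    inverse \<open>Q\<close> then acts as a square root of \<open>R\<close>.\<close>
  obtain P :: "real^'p^'p" where P: "transpose P ** R ** P = mat 1"
    by (rule simultaneous_diagonalization[OF R symR]) (rule that)
  obtain Q where Q: "P ** Q = mat 1"
    using invertible_of_congruence[OF P] by (auto simp: invertible_def)
  then have Qt: "transpose Q ** transpose P = mat 1"
    by (metis matrix_transpose_mul transpose_mat)
  have R_eq: "R = transpose Q ** Q"
  proof -
    have "transpose Q ** (transpose P ** R ** P) ** Q = R"
      using Q Qt by (metis matrix_mul_assoc matrix_mul_lid matrix_mul_rid)
    then show ?thesis by (simp add: P)
  qed
  define Y where "Y = X ** transpose Q"
  have Yt: "transpose Y = Q ** X"
    using X by (simp add: Y_def matrix_transpose_mul symmetric_matrix_def)
  have "trace (C ** X ** R ** X) = trace ((C ** Y) ** transpose Y)"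
    by (simp add: R_eq Yt) (simp add: Y_def matrix_mul_assoc)
  also have "\<dots> = trace (transpose Y ** C ** Y)"
    by (subst trace_mul_sym) (simp add: matrix_mul_assoc)
  also have "\<dots> = (\<Sum>i\<in>UNIV. column i Y \<bullet> (C *v column i Y))"
    by (simp add: trace_def congruence_entry)
  also have "\<dots> \<ge> 0"
    using C by (intro sum_nonneg) (simp add: pos_semidef_def)
  finally show ?thesis .
qed

lemma matrix_mult_add_left:
  fixes A B C :: "real^'p^'p"
  shows "(A + B) ** C = A ** C + B ** C"
  by (simp add: vec_eq_iff matrix_matrix_mult_def distrib_right sum.distrib)

lemma trace_mult_affine_right:
  fixes M X Y :: "real^'p^'p"
  shows "trace (M ** (u *\<^sub>R X + v *\<^sub>R Y)) = u * trace (M ** X) + v * trace (M ** Y)"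
  by (simp add: matrix_add_ldistrib matrix_scalar_ac scalar_matrix_assoc [symmetric]
      trace_add trace_scaleR)

text \<open>For a bilinear \<open>b\<close>, the convexity gap of \<open>b X X\<close> is
  \<open>u * v * b (X - Y) (X - Y)\<close>, which is nonnegative here.\<close>

lemma trace_quadratic_convex:
  fixes C R X Y :: "real^'p^'p"
  assumes C: "pos_semidef C" and R: "pos_def R"
    and X: "symmetric_matrix X" and Y: "symmetric_matrix Y"
    and uv: "0 \<le> u" "0 \<le> v" "u + v = 1"
  shows "trace (C ** (u *\<^sub>R X + v *\<^sub>R Y) ** R ** (u *\<^sub>R X + v *\<^sub>R Y))
    \<le> u * trace (C ** X ** R ** X) + v * trace (C ** Y ** R ** Y)"
proof -
  define b where "b X Y = trace (C ** X ** R ** Y)" for X Y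
  have b_right: "b Z (s *\<^sub>R X + t *\<^sub>R Y) = s * b Z X + t * b Z Y" for Z X Y s t
    unfolding b_def by (rule trace_mult_affine_right)
  have b_left: "b (s *\<^sub>R X + t *\<^sub>R Y) Z = s * b X Z + t * b Y Z" for Z X Y s t
    unfolding b_def
    by (simp add: matrix_add_ldistrib matrix_mult_add_left matrix_scalar_ac
        scalar_matrix_assoc [symmetric] trace_add trace_scaleR)
  have "b X (1 *\<^sub>R X + (-1) *\<^sub>R Y) - b Y (1 *\<^sub>R X + (-1) *\<^sub>R Y) = b (X - Y) (X - Y)"
    using b_left[of 1 X "-1" Y "X - Y"] by simp
  then have diff: "b (X - Y) (X - Y) = b X X - b X Y - b Y X + b Y Y"
    by (simp only: b_right)
  have "symmetric_matrix (X - Y)"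
    using X Y by (simp add: symmetric_matrix_def transpose_def vec_eq_iff)
  then have nonneg: "0 \<le> b (X - Y) (X - Y)"
    using trace_congruence_nonneg[OF C R] by (simp add: b_def)
  have v: "v = 1 - u" using uv by simp
  have "u * b X X + v * b Y Y - b (u *\<^sub>R X + v *\<^sub>R Y) (u *\<^sub>R X + v *\<^sub>R Y)
    = u * v * b (X - Y) (X - Y)"
    unfolding b_left b_right diff v by (simp add: algebra_simps)
  moreover have "0 \<le> u * v * b (X - Y) (X - Y)"
    using nonneg uv by simp
  ultimately show ?thesis by (simp add: b_def)
qed

section \<open>Convexity of the domains and of the off-diagonal norm\<close>

text \<open>\<open>B\<close> may be singular, as can be the correlation matrix \<open>C\<close> that
  the counterexample mixes with the identity.\<close>

lemma pos_def_conic_combination: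
  fixes A B :: "real^'p^'p"
  assumes A: "pos_def A" and B: "pos_semidef B" and uv: "0 < u" "0 \<le> v"
  shows "pos_def (u *\<^sub>R A + v *\<^sub>R B)"
  unfolding pos_def_def
proof (intro conjI allI impI)
  show "symmetric_matrix (u *\<^sub>R A + v *\<^sub>R B)"
    using A B by (simp add: pos_def_def pos_semidef_def symmetric_matrix_def transpose_def vec_eq_iff)
  fix x :: "real^'p" assume "x \<noteq> 0"
  have "x \<bullet> ((u *\<^sub>R A + v *\<^sub>R B) *v x) = u * (x \<bullet> (A *v x)) + v * (x \<bullet> (B *v x))"
    by (simp add: matrix_vector_mult_add_rdistrib scaleR_matrix_vector_assoc [symmetric]
        inner_add_right)
  also have "\<dots> > 0"
    using A B uv \<open>x \<noteq> 0\<close> by (intro add_pos_nonneg) (auto simp: pos_def_def pos_semidef_def)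
  finally show "0 < x \<bullet> ((u *\<^sub>R A + v *\<^sub>R B) *v x)" .
qed

lemma pos_def_imp_pos_semidef:
  fixes A :: "real^'p^'p"
  assumes "pos_def A"
  shows "pos_semidef A"
  unfolding pos_semidef_def
proof (intro conjI allI)
  show "symmetric_matrix A" using assms by (simp add: pos_def_def)
  show "0 \<le> x \<bullet> (A *v x)" for x
    using assms by (cases "x = 0") (auto simp: pos_def_def less_imp_le)
qed

lemma convex_pos_def_unit_diag: "convex (pos_def_unit_diag :: (real^'p^'p) set)"
proof (rule convexI)
  fix A B :: "real^'p^'p" and u v :: real
  assume AB: "A \<in> pos_def_unit_diag" "B \<in> pos_def_unit_diag" and uv: "0 \<le> u" "0 \<le> v" "u + v = 1"
  have "pos_def (u *\<^sub>R A + v *\<^sub>R B)"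
  proof (cases "u = 0")
    case True
    then show ?thesis using AB uv by (simp add: pos_def_unit_diag_def)
  next
    case False
    then show ?thesis
      using AB uv by (intro pos_def_conic_combination pos_def_imp_pos_semidef)
        (auto simp: pos_def_unit_diag_def)
  qed
  then show "u *\<^sub>R A + v *\<^sub>R B \<in> pos_def_unit_diag"
    using AB uv by (simp add: pos_def_unit_diag_def unit_diagonal_def)
qed

text \<open>The form is a sum of squares with positive weights.\<close>

lemma pos_diagonal_imp_pos_def:
  fixes D :: "real^'p^'p"
  assumes "D \<in> pos_diagonal"
  shows "pos_def D"
  unfolding pos_def_def
proof (intro conjI allI impI)
  have off: "D $ i $ j = 0" if "i \<noteq> j" for i j using assms that by (simp add: pos_diagonal_def)
  have diag: "0 < D $ i $ i" for i using assms by (simp add: pos_diagonal_def)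
  show "symmetric_matrix D"
    unfolding symmetric_matrix_def transpose_def vec_eq_iff
  proof (intro allI)
    show "(\<chi> i j. D $ j $ i) $ i $ j = D $ i $ j" for i j
      using off[of i j] off[of j i] by (cases "i = j") auto
  qed
  fix x :: "real^'p" assume "x \<noteq> 0"
  then obtain k where k: "x $ k \<noteq> 0" by (auto simp: vec_eq_iff)
  have "(D *v x) $ i = D $ i $ i * x $ i" for i
  proof -
    have "(D *v x) $ i = (\<Sum>j\<in>UNIV. if j = i then D $ i $ i * x $ i else 0)"
      unfolding matrix_vector_mult_def vec_lambda_beta by (rule sum.cong) (auto simp: off)
    then show ?thesis by simp
  qed
  then have "x \<bullet> (D *v x) = (\<Sum>i\<in>UNIV. D $ i $ i * (x $ i)\<^sup>2)"
    by (simp add: inner_vec_def power2_eq_square mult_ac)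
  also have "\<dots> > 0"
    using k diag by (intro sum_pos2[of _ k]) (auto simp: less_imp_le)
  finally show "0 < x \<bullet> (D *v x)" .
qed

lemma convex_pos_diagonal: "convex (pos_diagonal :: (real^'p^'p) set)"
proof (rule convexI)
  fix A B :: "real^'p^'p" and u v :: real
  assume AB: "A \<in> pos_diagonal" "B \<in> pos_diagonal" and uv: "0 \<le> u" "0 \<le> v" "u + v = 1"
  have "0 < u * A $ i $ i + v * B $ i $ i" for i
  proof (cases "u = 0")
    case True
    then show ?thesis using AB uv by (simp add: pos_diagonal_def)
  next
    case False
    then show ?thesis using AB uv
      by (intro add_pos_nonneg mult_pos_pos mult_nonneg_nonneg) (auto simp: pos_diagonal_def less_imp_le)
  qed
  then show "u *\<^sub>R A + v *\<^sub>R B \<in> pos_diagonal"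
    using AB by (simp add: pos_diagonal_def)
qed

lemma off_diag_norm1_convex:
  fixes A B :: "real^'p^'p"
  assumes "0 \<le> u" "0 \<le> v"
  shows "off_diag_norm1 (u *\<^sub>R A + v *\<^sub>R B) \<le> u * off_diag_norm1 A + v * off_diag_norm1 B"
proof -
  have "\<bar>u * A $ i $ j + v * B $ i $ j\<bar> \<le> u * \<bar>A $ i $ j\<bar> + v * \<bar>B $ i $ j\<bar>" for i j
    using assms abs_triangle_ineq[of "u * A $ i $ j" "v * B $ i $ j"] by (simp add: abs_mult)
  then show ?thesis
    unfolding off_diag_norm1_def sum_distrib_left sum.distrib[symmetric]
    by (auto intro!: sum_mono)
qed

section \<open>Strict convexity in each variable\<close>

text \<open>Strictness comes from \<open>- ln (det R)\<close>: the trace term is linear in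
  \<open>R\<close>, the penalty is convex since \<open>lam\<close> is nonnegative, and
  \<open>ln (det D)\<close> is constant.\<close>

lemma strictly_convex_objective_R:
  assumes lam: "0 \<le> lam"
  shows "strictly_convex_on pos_def_unit_diag (\<lambda>R. objective C lam \<alpha> R D)"
  unfolding strictly_convex_on_def
proof (intro conjI convex_pos_def_unit_diag ballI allI impI)
  fix A B :: "real^'a^'a" and u v :: real
  assume AB: "A \<in> pos_def_unit_diag" "B \<in> pos_def_unit_diag"
    and uv: "0 < u" "0 < v" and "A \<noteq> B" and uv1: "u + v = 1"
  have tr: "trace (C ** D ** (u *\<^sub>R A + v *\<^sub>R B) ** D) =
      u * trace (C ** D ** A ** D) + v * trace (C ** D ** B ** D)"
    by (simp add: matrix_add_ldistrib matrix_mult_add_left matrix_scalar_ac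
        scalar_matrix_assoc [symmetric] trace_add trace_scaleR)
  have "u * ln (det A) + v * ln (det B) < ln (det (u *\<^sub>R A + v *\<^sub>R B))"
    using AB \<open>A \<noteq> B\<close> uv uv1 by (intro ln_det_strictly_concave) (auto simp: pos_def_unit_diag_def)
  moreover have "lam * off_diag_norm1 (u *\<^sub>R A + v *\<^sub>R B)
      \<le> lam * (u * off_diag_norm1 A + v * off_diag_norm1 B)"
    using lam uv by (intro mult_left_mono off_diag_norm1_convex) auto
  moreover have "k = u * k + v * k" for k :: real
    using uv1 by (metis distrib_right mult_1)
  from this[of "2 * (1 - \<alpha>) * ln (det D)"]
  have "2 * (1 - \<alpha>) * ln (det D) = u * (2 * (1 - \<alpha>) * ln (det D)) + v * (2 * (1 - \<alpha>) * ln (det D))" .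
  ultimately show "objective C lam \<alpha> (u *\<^sub>R A + v *\<^sub>R B) D
      < u * objective C lam \<alpha> A D + v * objective C lam \<alpha> B D"
    unfolding objective_def tr by (simp add: distrib_left right_diff_distrib mult.left_commute[of lam])
qed

text \<open>Strictness comes from \<open>ln (det D)\<close>, whose coefficient
  \<open>- 2 * (1 - \<alpha>)\<close> is negative; the trace term is a convex quadratic form, and
  the terms in \<open>R\<close> alone are constant.\<close>

lemma strictly_convex_objective_D:
  assumes C: "pos_semidef C" and R: "pos_def R" and \<alpha>: "\<alpha> < 1"
  shows "strictly_convex_on pos_diagonal (objective C lam \<alpha> R)"
  unfolding strictly_convex_on_def
proof (intro conjI convex_pos_diagonal ballI allI impI)
  fix A B :: "real^'a^'a" and u v :: real
  assume "A \<in> pos_diagonal" "B \<in> pos_diagonal"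
    and uv: "0 < u" "0 < v" and "A \<noteq> B" and uv1: "u + v = 1"
  then have A: "pos_def A" and B: "pos_def B" by (simp_all add: pos_diagonal_imp_pos_def)
  then have "trace (C ** (u *\<^sub>R A + v *\<^sub>R B) ** R ** (u *\<^sub>R A + v *\<^sub>R B))
    \<le> u * trace (C ** A ** R ** A) + v * trace (C ** B ** R ** B)"
    using C R uv uv1 by (intro trace_quadratic_convex) (auto simp: pos_def_def)
  moreover have "2 * (1 - \<alpha>) * (u * ln (det A) + v * ln (det B))
      < 2 * (1 - \<alpha>) * ln (det (u *\<^sub>R A + v *\<^sub>R B))"
    using ln_det_strictly_concave[OF A B \<open>A \<noteq> B\<close> uv uv1] \<alpha> by (intro mult_strict_left_mono) auto
  moreover have "k = u * k + v * k" for k :: real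
    using uv1 by (metis distrib_right mult_1)
  from this[of "lam * off_diag_norm1 R - ln (det R)"]
  have "lam * off_diag_norm1 R - ln (det R) =
    u * (lam * off_diag_norm1 R - ln (det R)) + v * (lam * off_diag_norm1 R - ln (det R))" .
  ultimately show "objective C lam \<alpha> R (u *\<^sub>R A + v *\<^sub>R B)
      < u * objective C lam \<alpha> R A + v * objective C lam \<alpha> R B"
    unfolding objective_def by (simp add: distrib_left right_diff_distrib mult.left_commute)
qed

section \<open>Joint convexity for the identity matrix\<close>

lemma pos_def_mat_1: "pos_def (mat 1 :: real^'p^'p)"
  by (simp add: pos_def_def symmetric_matrix_def)

lemma unit_diagonal_mat_1: "unit_diagonal (mat 1 :: real^'p^'p)"
  by (simp add: unit_diagonal_def mat_def)

text \<open>A diagonal \<open>D\<close> on both sides scales the entry \<open>R $ i $ i = 1\<close>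
  by \<open>(D $ i $ i)\<^sup>2\<close>, so the trace depends on \<open>D\<close> alone.\<close>

lemma trace_diagonal_congruence:
  fixes D R :: "real^'p^'p"
  assumes D: "D \<in> pos_diagonal" and R: "unit_diagonal R"
  shows "trace (D ** R ** D) = (\<Sum>i\<in>UNIV. (D $ i $ i)\<^sup>2)"
proof -
  have Dt: "transpose D = D"
    using pos_diagonal_imp_pos_def[OF D] by (simp add: pos_def_def symmetric_matrix_def)
  have col: "column i D = D $ i $ i *\<^sub>R axis i 1" for i
    using D by (auto simp: column_def vec_eq_iff axis_def pos_diagonal_def)
  have "(D ** R ** D) $ i $ i = (D $ i $ i)\<^sup>2" for i
    using congruence_entry[of D R i i] R
    by (simp add: Dt col matrix_vector_mult_scaleR inner_axis' matrix_vector_mul_component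
        inner_axis unit_diagonal_def power2_eq_square)
  then show ?thesis by (simp add: trace_def)
qed

text \<open>For \<open>C = mat 1\<close> the objective separates into a convex function of
  \<open>R\<close> plus a convex function of \<open>D\<close>.\<close>

lemma convex_objective_identity:
  assumes lam: "0 \<le> lam" and \<alpha>: "\<alpha> < 1"
  shows "convex_on (pos_def_unit_diag \<times> pos_diagonal)
    (\<lambda>(R, D). objective (mat 1 :: real^'p^'p) lam \<alpha> R D)"
proof (rule convex_onI)
  show "convex (pos_def_unit_diag \<times> (pos_diagonal :: (real^'p^'p) set))"
    by (intro convex_Times convex_pos_def_unit_diag convex_pos_diagonal)
  fix t :: real and x y :: "(real^'p^'p) \<times> (real^'p^'p)"
  assume t: "0 < t" "t < 1"
    and xy: "x \<in> pos_def_unit_diag \<times> pos_diagonal" "y \<in> pos_def_unit_diag \<times> pos_diagonal"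
  obtain R D R' D' where x: "x = (R, D)" and y: "y = (R', D')" by (cases x, cases y)
  have R: "R \<in> pos_def_unit_diag" "R' \<in> pos_def_unit_diag"
    and D: "D \<in> pos_diagonal" "D' \<in> pos_diagonal"
    using xy by (auto simp: x y)
  define u where "u = 1 - t"
  have u: "0 < u" "u + t = 1" using t by (simp_all add: u_def)
  define Rm where "Rm = u *\<^sub>R R + t *\<^sub>R R'"
  define Dm where "Dm = u *\<^sub>R D + t *\<^sub>R D'"
  have Rm: "Rm \<in> pos_def_unit_diag"
    unfolding Rm_def using R t u by (intro convexD[OF convex_pos_def_unit_diag]) auto
  have Dm: "Dm \<in> pos_diagonal"
    unfolding Dm_def using D t u by (intro convexD[OF convex_pos_diagonal]) auto
  have unit: "unit_diagonal S" if "S \<in> pos_def_unit_diag" for S :: "real^'p^'p"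
    using that by (simp add: pos_def_unit_diag_def)
  \<comment> \<open>Comparing \<open>S\<close> with the identity removes \<open>R\<close> from the
    trace term, the only one that couples it with \<open>D\<close>.\<close>
  have sq: "trace (E ** S ** E) = trace (E ** E)"
    if "S \<in> pos_def_unit_diag" "E \<in> pos_diagonal" for S E :: "real^'p^'p"
    using trace_diagonal_congruence[OF that(2) unit[OF that(1)]]
      trace_diagonal_congruence[OF that(2) unit_diagonal_mat_1]
    by simp
  have pd: "pos_def D" "pos_def D'" "pos_def R" "pos_def R'"
    using D R by (auto simp: pos_diagonal_imp_pos_def pos_def_unit_diag_def)
  have "trace (Dm ** Dm) \<le> u * trace (D ** D) + t * trace (D' ** D')"
    using trace_quadratic_convex[OF pos_def_imp_pos_semidef[OF pos_def_mat_1] pos_def_mat_1, of D D' u t]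
      pd t u by (simp add: pos_def_def Dm_def)
  moreover have "2 * (1 - \<alpha>) * (u * ln (det D) + t * ln (det D')) \<le> 2 * (1 - \<alpha>) * ln (det Dm)"
    unfolding Dm_def using ln_det_concave[OF pd(1,2) u(1) t(1) u(2)] \<alpha>
    by (intro mult_left_mono) auto
  moreover have "u * ln (det R) + t * ln (det R') \<le> ln (det Rm)"
    unfolding Rm_def using ln_det_concave[OF pd(3,4) u(1) t(1) u(2)] .
  moreover have "lam * off_diag_norm1 Rm \<le> lam * (u * off_diag_norm1 R + t * off_diag_norm1 R')"
    unfolding Rm_def using lam t u by (intro mult_left_mono off_diag_norm1_convex) auto
  ultimately have "objective (mat 1) lam \<alpha> Rm Dm
      \<le> u * objective (mat 1) lam \<alpha> R D + t * objective (mat 1) lam \<alpha> R' D'"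
    unfolding objective_def using R D Rm Dm
    by (simp add: sq) (simp add: distrib_left right_diff_distrib mult.left_commute)
  then show "(case (1 - t) *\<^sub>R x + t *\<^sub>R y of (R, D) \<Rightarrow> objective (mat 1) lam \<alpha> R D)
      \<le> (1 - t) * (case x of (R, D) \<Rightarrow> objective (mat 1) lam \<alpha> R D)
        + t * (case y of (R, D) \<Rightarrow> objective (mat 1) lam \<alpha> R D)"
    by (simp add: x y Rm_def Dm_def u_def)
qed

section \<open>Failure of joint convexity for other correlation matrices\<close>

text \<open>With \<open>C = E + mat 1\<close>, the matrix \<open>E\<close> is symmetric, nonzero and
  of trace 0, so \<open>trace (C ** C)\<close> exceeds the dimension by
  \<open>trace (E ** E)\<close>, the sum of the squared column norms of \<open>E\<close>.\<close>

lemma trace_square_correlation_gt: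
  fixes C :: "real^'p^'p"
  assumes C: "correlation_matrix C" and "C \<noteq> mat 1"
  shows "real CARD('p) < trace (C ** C)"
proof -
  have Ct: "transpose C = C"
    using C by (simp add: correlation_matrix_def pos_semidef_def symmetric_matrix_def)
  have trC: "trace C = real CARD('p)"
    using C by (simp add: correlation_matrix_def unit_diagonal_def trace_def)
  define E where "E = C - mat 1"
  have E_eq: "C = E + mat 1" by (simp add: E_def)
  have Et: "transpose E = E"
    using Ct by (simp add: E_def transpose_def vec_eq_iff mat_def)
  have "E \<noteq> 0" using assms(2) by (simp add: E_def)
  then obtain k where k: "column k E \<noteq> 0"
    by (auto simp: vec_eq_iff column_def)
  have "0 < (\<Sum>i\<in>UNIV. column i E \<bullet> column i E)"
    using k by (intro sum_pos2[of _ k]) auto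
  also have "\<dots> = trace (E ** E)"
    using congruence_entry[of E "mat 1"] by (simp add: trace_def Et)
  finally have pos: "0 < trace (E ** E)" .
  have "trace E = 0"
    using trC by (simp add: E_def trace_sub trace_I)
  moreover have "trace (C ** C) = trace (E ** E) + trace E + (trace E + real CARD('p))"
    unfolding E_eq
    by (simp only: matrix_add_ldistrib matrix_mult_add_left trace_add trace_I
        matrix_mul_lid matrix_mul_rid)
  ultimately show ?thesis using pos by simp
qed

lemma objective_scaled_identity:
  fixes C R :: "real^'p^'p"
  assumes "0 < t"
  shows "objective C lam \<alpha> R (t *\<^sub>R mat 1) = - ln (det R) + lam * off_diag_norm1 R
    - 2 * (1 - \<alpha>) * (real CARD('p) * ln t) + t\<^sup>2 * trace (C ** R)"
proof -
  have "det (t *\<^sub>R mat 1 :: real^'p^'p) = t ^ CARD('p)"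
    by (subst det_diagonal) (auto simp: mat_def)
  then have "ln (det (t *\<^sub>R mat 1 :: real^'p^'p)) = real CARD('p) * ln t"
    using assms by (simp add: ln_realpow)
  moreover have "trace (C ** (t *\<^sub>R mat 1) ** R ** (t *\<^sub>R mat 1)) = t\<^sup>2 * trace (C ** R)"
    by (simp add: matrix_scalar_ac scalar_matrix_assoc [symmetric] trace_scaleR power2_eq_square)
  ultimately show ?thesis by (simp add: objective_def)
qed

text \<open>On scalar matrices \<open>D = t I\<close> the trace term is \<open>t^2 * s\<close> with
  \<open>s = trace (C ** R)\<close>, and this function of \<open>(t, s)\<close> has an indefinite
  Hessian for positive \<open>t\<close>. The chosen segment decreases \<open>t\<close> while
  increasing \<open>s\<close>.\<close>

lemma not_convex_objective:
  fixes C :: "real^'p^'p"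
  assumes C: "correlation_matrix C" and "C \<noteq> mat 1" and \<alpha>: "\<alpha> < 1"
  shows "\<not> convex_on (pos_def_unit_diag \<times> pos_diagonal) (\<lambda>(R, D). objective C lam \<alpha> R D)"
proof
  assume conv: "convex_on (pos_def_unit_diag \<times> pos_diagonal) (\<lambda>(R, D). objective C lam \<alpha> R D)"
  define p where "p = real CARD('p)"
  define a where "a = trace (C ** C) - p"
  have a: "0 < a" using trace_square_correlation_gt[OF assms(1,2)] by (simp add: a_def p_def)
  have trC: "trace C = p"
    using C by (simp add: correlation_matrix_def unit_diagonal_def trace_def p_def)
  \<comment> \<open>Averaging with the identity makes \<open>R\<close> positive definite even for
    singular \<open>C\<close> and raises \<open>trace (C ** R)\<close> above \<open>trace C\<close>
    by \<open>a / 2\<close>.\<close>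
  define R where "R = (1/2) *\<^sub>R mat 1 + (1/2) *\<^sub>R C"
  define M where "M = (1/2) *\<^sub>R mat 1 + (1/2) *\<^sub>R R"
  have I: "mat 1 \<in> (pos_def_unit_diag :: (real^'p^'p) set)"
    by (simp add: pos_def_unit_diag_def pos_def_mat_1 unit_diagonal_mat_1)
  have R: "R \<in> pos_def_unit_diag"
    using C unit_diagonal_mat_1[where 'p = 'p]
    by (auto intro!: pos_def_conic_combination pos_def_mat_1
        simp: R_def pos_def_unit_diag_def correlation_matrix_def unit_diagonal_def)
  have trR: "trace (C ** R) = p + a / 2"
    unfolding R_def trace_mult_affine_right by (simp add: trC a_def field_simps)
  have trM: "trace (C ** M) = p + a / 4"
    unfolding M_def trace_mult_affine_right by (simp add: trC trR field_simps)
  define K where "K S = - ln (det S) + lam * off_diag_norm1 S" for S :: "real^'p^'p"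
  define b where "b = (1 - \<alpha>) * p"
  have b: "0 \<le> b" using \<alpha> by (simp add: b_def p_def)
  have obj: "objective C lam \<alpha> S (t *\<^sub>R mat 1) = K S - 2 * b * ln t + t\<^sup>2 * trace (C ** S)"
    if "0 < t" for S t
    using objective_scaled_identity[OF that, of C lam \<alpha> S] by (simp add: K_def b_def p_def)
  \<comment> \<open>Collects what stays bounded in \<open>t\<close> in the midpoint inequality;
    \<open>b * ln 2\<close> absorbs the logarithms of \<open>t\<close>, \<open>t + 1\<close> and
    \<open>t - 1\<close>.\<close>
  define c where "c = (K (mat 1) + K R) / 2 - K M + p + a / 4 + b * ln 2"
  have bound: "a * t / 2 \<le> c" if t: "2 \<le> t" for t
  proof -
    have diag: "s *\<^sub>R mat 1 \<in> (pos_diagonal :: (real^'p^'p) set)" if "0 < s" for s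
      using that by (simp add: pos_diagonal_def mat_def)
    have mid: "(1/2) *\<^sub>R ((t + 1) *\<^sub>R mat 1) + (1/2) *\<^sub>R ((t - 1) *\<^sub>R mat 1) = (t *\<^sub>R mat 1 :: real^'p^'p)"
      by (simp add: vec_eq_iff field_simps)
    have "objective C lam \<alpha> M (t *\<^sub>R mat 1) \<le> 1/2 * objective C lam \<alpha> (mat 1) ((t + 1) *\<^sub>R mat 1)
        + 1/2 * objective C lam \<alpha> R ((t - 1) *\<^sub>R mat 1)"
    proof -
      let ?x = "(mat 1 :: real^'p^'p, (t + 1) *\<^sub>R mat 1 :: real^'p^'p)"
      let ?y = "(R, (t - 1) *\<^sub>R mat 1 :: real^'p^'p)"
      have x: "?x \<in> pos_def_unit_diag \<times> pos_diagonal"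
        using I diag[of "t + 1"] t by simp
      have y: "?y \<in> pos_def_unit_diag \<times> pos_diagonal"
        using R diag[of "t - 1"] t by simp
      have "(1 - 1/2) *\<^sub>R ?x + (1/2) *\<^sub>R ?y = (M, t *\<^sub>R mat 1)"
        using mid by (simp add: M_def)
      then show ?thesis
        using convex_onD[OF conv _ _ x y, of "1/2"] by simp
    qed
    \<comment> \<open>The terms in \<open>t^2\<close> cancel because \<open>p + a / 4\<close> is the
      mean of \<open>p\<close> and \<open>p + a / 2\<close>; the term \<open>- a * t / 2\<close>
      survives.\<close>
    moreover have "1/2 * ((t + 1)\<^sup>2 * p) + 1/2 * ((t - 1)\<^sup>2 * (p + a / 2)) - t\<^sup>2 * (p + a / 4)
        = p + a / 4 - a * t / 2"
      by (simp add: power2_eq_square field_simps)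
    moreover have "1/2 * (2 * b * ln (t + 1)) + 1/2 * (2 * b * ln (t - 1)) + b * ln 2 \<ge> 2 * b * ln t"
    proof -
      \<comment> \<open>From \<open>2 \<le> t\<close> follows \<open>t \<le> 2 * (t - 1)\<close>, so
        lowering \<open>t\<close> by 1 costs at most \<open>ln 2\<close>.\<close>
      have "ln t \<le> ln (2 * (t - 1))" using t by (intro ln_mono) auto
      also have "\<dots> = ln 2 + ln (t - 1)" using t by (intro ln_mult_pos) auto
      finally have "2 * ln t \<le> ln (t + 1) + ln (t - 1) + ln 2"
        using ln_mono[of t "t + 1"] t by linarith
      from mult_left_mono[OF this b] show ?thesis by (simp add: algebra_simps)
    qed
    ultimately show ?thesis
      using t by (simp add: obj trM trR trC c_def distrib_left right_diff_distrib) argo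
  qed
  \<comment> \<open>Large enough that \<open>a * t\<close> is at least \<open>2 * c + a\<close>,
    against \<open>bound\<close>; the maximum with 2 secures the premise of
    \<open>bound\<close>.\<close>
  define t where "t = max 2 (2 * c / a + 1)"
  have "a * (2 * c / a + 1) \<le> a * t"
    using a by (intro mult_left_mono) (auto simp: t_def)
  moreover have "a * (2 * c / a + 1) = 2 * c + a"
    using a by (simp add: field_simps)
  ultimately show False
    using bound[of t] a by (simp add: t_def)
qed

theorem lemma1:
  fixes C :: "real^'p^'p" and lam \<alpha> :: real
  assumes "correlation_matrix C" and "0 \<le> lam" and "\<alpha> < 1"
  shows "strictly_biconvex_on pos_def_unit_diag pos_diagonal (objective C lam \<alpha>) \<and>
    (convex_on (pos_def_unit_diag \<times> pos_diagonal) (\<lambda>(R, D). objective C lam \<alpha> R D)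
      \<longleftrightarrow> C = mat 1)"
proof (intro conjI iffI)
  show "strictly_biconvex_on pos_def_unit_diag pos_diagonal (objective C lam \<alpha>)"
    unfolding strictly_biconvex_on_def
  proof (intro conjI ballI)
    fix R :: "real^'p^'p" assume "R \<in> pos_def_unit_diag"
    then show "strictly_convex_on pos_diagonal (\<lambda>D. objective C lam \<alpha> R D)"
      using assms by (intro strictly_convex_objective_D)
        (auto simp: pos_def_unit_diag_def correlation_matrix_def)
  next
    fix D :: "real^'p^'p"
    show "strictly_convex_on pos_def_unit_diag (\<lambda>R. objective C lam \<alpha> R D)"
      using assms(2) by (rule strictly_convex_objective_R)
  qed
next
  assume "convex_on (pos_def_unit_diag \<times> pos_diagonal) (\<lambda>(R, D). objective C lam \<alpha> R D)"
  then show "C = mat 1" using not_convex_objective assms(1,3) by blast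
next
  assume "C = mat 1"
  then show "convex_on (pos_def_unit_diag \<times> pos_diagonal) (\<lambda>(R, D). objective C lam \<alpha> R D)"
    using convex_objective_identity[OF assms(2,3)] by simp
qed

end
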